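(* Let $n\ge 3$, let $\mathcal F_n\subset\mathcal P_n$ be closed with respect to similarities and relabellings, and let $\Phi:\mathcal F_n\to\mathbb R^2$ be a map. Then the following two conditions are equivalent: (a) $\Phi$ is an $n$-gon center. (b) There exists an $n$-gon center function $g:\widetilde{\mathcal F}_n\to\mathbb R$ (which may not be unique) such that, for every $P=(V_1,\ldots,V_n)$ in $\mathcal F_n$ with distance matrix $[d_{ij}]$, $$\Phi(P)=\lambda_1V_1+\lambda_2V_2+\ldots+\lambda_nV_n,$$ where, for $k=1,\ldots,n$, $$\lambda_k=\frac{g([d_{\rho^{k-1}(i)\rho^{k-1}(j)}])}{g([d_{ij}])+g([d_{\rho(i)\rho(j)}])+\ldots+g([d_{\rho^{n-1}(i)\rho^{n-1}(j)}])}.$$ (In particular, the denominators are required to be nonzero.)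
   Context: For $n\ge 3$, $\mathcal P_n$ is the set of all $n$-gons with labelled vertices in the plane, i.e. all $n$-tuples $(V_1,\ldots,V_n)$ of points of $\mathbb R^2$ (no non-degeneracy is assumed). Let $\rho,\sigma$ be the permutations of $\{1,\ldots,n\}$ given by $\rho(i)=i+1 \bmod n$ and $\sigma(i)=n+2-i \bmod n$ (values taken in $\{1,\dots,n\}$), and let $D_n$ be the dihedral group of order $2n$ they generate. Two $n$-gons $(V_1,\ldots,V_n)$, $(V_1',\ldots,V_n')$ differ only in their labelling if there is $\alpha\in D_n$ with $V_i'=V_{\alpha(i)}$ for all $i$. Two $n$-gons $(V_i)$, $(V_i')$ are similar via a plane similarity $T$ (orientation-preserving or reversing) if $T(V_i)=V_i'$ for all $i$. A subset $\mathcal F_n\subset\mathcal P_n$ is closed with respect to similarities and relabellings if every $n$-gon similar to an element of $\mathcal F_n$, and every $n$-gon differing only in its labelling from an element of $\mathcal F_n$, is in $\mathcal F_n$. An $n$-gon center is a function $\Phi:\mathcal F_n\to\mathbb R^2$ (with $\mathcal F_n$ closed with respect to similarities and relabellings) such that (1) it commutes with similarities: $\Phi(T(P))=T(\Phi(P))$ for every plane similarity $T$ and $P\in\mathcal F_n$, where $T(P)=(T(V_1),\ldots,T(V_n))$; (2) it is invariant with respect to relabellings: if $P,Q\in\mathcal F_n$ differ only in their labelling, then $\Phi(P)=\Phi(Q)$. $\mathcal T_n$ is the quotient of $\mathcal P_n$ by plane congruences (mapping vertex $i$ to vertex $i$ for each $i$); its elements are identified with the distance matrices $[d_{ij}]_{1\le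 i,j\le n}$, $d_{ij}=d(V_i,V_j)$. $\widetilde{\mathcal F}_n$ is the projection of $\mathcal F_n$ onto $\mathcal T_n$. For a permutation $\alpha$, $[d_{\alpha(i)\alpha(j)}]$ is the matrix whose $(i,j)$ entry is $d_{\alpha(i)\alpha(j)}$. An $n$-gon center function is a function $g:\widetilde{\mathcal F}_n\to\mathbb R$ such that (i) (symmetry) $g([d_{ij}])=g([d_{\sigma(i)\sigma(j)}])$; (ii) (homogeneity) there exists $m\in\mathbb N$ (with $0\in\mathbb N$) such that $g([\lambda d_{ij}])=\lambda^m g([d_{ij}])$ for every $\lambda\in\mathbb R_{>0}$. *)

theory Defs
  imports "HOL-Analysis.Analysis" "HOL-Algebra.Sym_Groups"
begin

text \<open>
  Indices run over \<open>{1..n}\<close>. An n-gon is an extensional function on \<open>{1..n}\<close>, and an n by n matrix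
  is extensional in both indices, so that equality of n-gons and of matrices is HOL equality.
\<close>

definition ngons :: "nat \<Rightarrow> (nat \<Rightarrow> real ^ 2) set" where
  "ngons n = {1..n} \<rightarrow>\<^sub>E UNIV"

definition matrix_on :: "nat \<Rightarrow> (nat \<Rightarrow> nat \<Rightarrow> real) \<Rightarrow> nat \<Rightarrow> nat \<Rightarrow> real" where
  "matrix_on n a = (\<lambda>i\<in>{1..n}. \<lambda>j\<in>{1..n}. a i j)"

text \<open>The representative in \<open>{1..n}\<close> of \<open>k\<close> modulo \<open>n\<close>.\<close>

definition cyc :: "nat \<Rightarrow> nat \<Rightarrow> nat" where
  "cyc n k = (if k mod n = 0 then n else k mod n)"

text \<open>
  Being elements of \<^const>\<open>sym_group\<close>, the permutations are the identity outside \<open>{1..n}\<close>. The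
  subtraction in \<open>\<sigma>\<close> is never truncated for \<open>i \<le> n\<close>.
\<close>

definition rho :: "nat \<Rightarrow> nat \<Rightarrow> nat" where
  "rho n i = (if i \<in> {1..n} then cyc n (i + 1) else i)"

definition sigma :: "nat \<Rightarrow> nat \<Rightarrow> nat" where
  "sigma n i = (if i \<in> {1..n} then cyc n (n + 2 - i) else i)"

definition dihedral :: "nat \<Rightarrow> (nat \<Rightarrow> nat) set" where
  "dihedral n = generate (sym_group n) {rho n, sigma n}"

definition differ_only_in_labelling ::
    "nat \<Rightarrow> (nat \<Rightarrow> real ^ 2) \<Rightarrow> (nat \<Rightarrow> real ^ 2) \<Rightarrow> bool" where
  "differ_only_in_labelling n P Q \<longleftrightarrow> (\<exists>\<alpha>\<in>dihedral n. \<forall>i\<in>{1..n}. Q i = P (\<alpha> i))"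

text \<open>Orientation-preserving and orientation-reversing similarities are both included.\<close>

definition similarity :: "(real ^ 2 \<Rightarrow> real ^ 2) \<Rightarrow> bool" where
  "similarity T \<longleftrightarrow> (\<exists>r>0. \<forall>x y. dist (T x) (T y) = r * dist x y)"

definition map_ngon :: "nat \<Rightarrow> (real ^ 2 \<Rightarrow> real ^ 2) \<Rightarrow> (nat \<Rightarrow> real ^ 2) \<Rightarrow> nat \<Rightarrow> real ^ 2" where
  "map_ngon n T P = (\<lambda>i\<in>{1..n}. T (P i))"

definition similar_ngons :: "nat \<Rightarrow> (nat \<Rightarrow> real ^ 2) \<Rightarrow> (nat \<Rightarrow> real ^ 2) \<Rightarrow> bool" where
  "similar_ngons n P Q \<longleftrightarrow> (\<exists>T. similarity T \<and> (\<forall>i\<in>{1..n}. T (P i) = Q i))"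

definition closed_family :: "nat \<Rightarrow> (nat \<Rightarrow> real ^ 2) set \<Rightarrow> bool" where
  "closed_family n F \<longleftrightarrow>
     F \<subseteq> ngons n \<and>
     (\<forall>P\<in>F. \<forall>Q\<in>ngons n. similar_ngons n P Q \<longrightarrow> Q \<in> F) \<and>
     (\<forall>P\<in>F. \<forall>Q\<in>ngons n. differ_only_in_labelling n P Q \<longrightarrow> Q \<in> F)"

text \<open>Only the values of \<open>\<Phi>\<close> on \<open>F\<close> matter.\<close>

definition ngon_center ::
    "nat \<Rightarrow> (nat \<Rightarrow> real ^ 2) set \<Rightarrow> ((nat \<Rightarrow> real ^ 2) \<Rightarrow> real ^ 2) \<Rightarrow> bool" where
  "ngon_center n F \<Phi> \<longleftrightarrow>
     closed_family n F \<and>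
     (\<forall>T. similarity T \<longrightarrow> (\<forall>P\<in>F. \<Phi> (map_ngon n T P) = T (\<Phi> P))) \<and>
     (\<forall>P\<in>F. \<forall>Q\<in>F. differ_only_in_labelling n P Q \<longrightarrow> \<Phi> P = \<Phi> Q)"

definition dist_matrix :: "nat \<Rightarrow> (nat \<Rightarrow> real ^ 2) \<Rightarrow> nat \<Rightarrow> nat \<Rightarrow> real" where
  "dist_matrix n P = matrix_on n (\<lambda>i j. dist (P i) (P j))"

definition permute_matrix ::
    "nat \<Rightarrow> (nat \<Rightarrow> nat) \<Rightarrow> (nat \<Rightarrow> nat \<Rightarrow> real) \<Rightarrow> nat \<Rightarrow> nat \<Rightarrow> real" where
  "permute_matrix n \<alpha> d = matrix_on n (\<lambda>i j. d (\<alpha> i) (\<alpha> j))"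

definition scale_matrix :: "nat \<Rightarrow> real \<Rightarrow> (nat \<Rightarrow> nat \<Rightarrow> real) \<Rightarrow> nat \<Rightarrow> nat \<Rightarrow> real" where
  "scale_matrix n c d = matrix_on n (\<lambda>i j. c * d i j)"

text \<open>
  The projection of \<open>F\<close> to the quotient of the n-gons by congruences, where a congruence class is
  identified with the common distance matrix of its members.
\<close>

definition projection :: "nat \<Rightarrow> (nat \<Rightarrow> real ^ 2) set \<Rightarrow> (nat \<Rightarrow> nat \<Rightarrow> real) set" where
  "projection n F = dist_matrix n ` F"

text \<open>Only the values of \<open>g\<close> on \<open>projection n F\<close> matter.\<close>

definition ngon_center_function ::
    "nat \<Rightarrow> (nat \<Rightarrow> real ^ 2) set \<Rightarrow> ((nat \<Rightarrow> nat \<Rightarrow> real) \<Rightarrow> real) \<Rightarrow> bool" where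
  "ngon_center_function n F g \<longleftrightarrow>
     (\<forall>d\<in>projection n F. g d = g (permute_matrix n (sigma n) d)) \<and>
     (\<exists>m::nat. \<forall>c>0. \<forall>d\<in>projection n F. g (scale_matrix n c d) = c ^ m * g d)"

end

theory Submission
  imports Defs
begin

text \<open>
  A center function gives affine combinations of the vertices. Similarities commute with affine
  combinations and multiply all the weights by one and the same power of their ratio
  (\<open>weighted_mean_similarity\<close>); relabelling by \<open>\<rho>\<close> shifts the weights cyclically
  (\<open>weighted_mean_rho\<close>), and relabelling by \<open>\<sigma>\<close> reverses them because of the symmetry of the center
  function (\<open>weighted_mean_sigma\<close>). As \<open>\<rho>\<close> and \<open>\<sigma>\<close> generate the dihedral group, the result is a center.

  Conversely, let \<open>\<Phi>\<close> be a center. A reflection whose axis contains all the vertices of \<open>P\<close> fixes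
  \<open>\<Phi> P\<close>, hence \<open>\<Phi> P\<close> lies in the affine span of the vertices (\<open>ngon_center_in_affine_span\<close>).
  Its barycentric coordinates with respect to the vertices are not unique when \<open>n > 3\<close> or the
  polygon is degenerate, and an arbitrary choice would break the symmetry. Those of least Euclidean
  norm are unique, and are therefore unchanged by similarities and permuted along with the vertices.
  A similarity exists as soon as the distance matrices are proportional
  (\<open>proportional_families_similar\<close>), so the first of these coordinates depends only on the distance
  matrix, up to scaling. It is the required center function: it is homogeneous of degree 0, it is
  symmetric because \<open>\<sigma>\<close> fixes the label 1, and its values at the cyclic relabellings are the
  remaining coordinates, with sum 1 (\<open>first_weight_represents\<close>).
\<close>

section \<open>Reflections, congruences and similarities\<close>

text \<open>
  The reflection in the hyperplane through \<open>p\<close> that is orthogonal to \<open>v\<close>; it is the identity if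
  \<open>v = 0\<close>.
\<close>

definition reflection :: "'a::real_inner \<Rightarrow> 'a \<Rightarrow> 'a \<Rightarrow> 'a" where
  "reflection p v x = x - (2 * ((x - p) \<bullet> v) / (v \<bullet> v)) *\<^sub>R v"

lemma dist_reflection: "dist (reflection p v x) (reflection p v y) = dist x y"
proof (cases "v = 0")
  case True
  then show ?thesis by (simp add: reflection_def)
next
  case False
  define t where "t = 2 * ((x - y) \<bullet> v) / (v \<bullet> v)"
  have eq: "reflection p v x - reflection p v y = (x - y) - t *\<^sub>R v"
    unfolding reflection_def t_def
    by (simp add: inner_diff_left algebra_simps diff_divide_distrib)
  have "t * (v \<bullet> v) = 2 * ((x - y) \<bullet> v)"
    using False by (simp add: t_def)
  then have "t * (t * (v \<bullet> v)) = 2 * t * ((x - y) \<bullet> v)"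
    by simp
  moreover have "(d - t *\<^sub>R v) \<bullet> (d - t *\<^sub>R v) = d \<bullet> d - 2 * t * (d \<bullet> v) + t * (t * (v \<bullet> v))" for d
    by (simp add: inner_diff_left inner_diff_right inner_commute algebra_simps)
  ultimately have "((x - y) - t *\<^sub>R v) \<bullet> ((x - y) - t *\<^sub>R v) = (x - y) \<bullet> (x - y)"
    by simp
  then show ?thesis
    by (simp add: dist_norm eq norm_eq_sqrt_inner)
qed

lemma reflection_fixes: "(x - p) \<bullet> v = 0 \<Longrightarrow> reflection p v x = x"
  by (simp add: reflection_def)

lemma reflection_bisector:
  assumes "a \<noteq> b"
  shows "reflection ((1/2) *\<^sub>R (a + b)) (a - b) a = b"
proof -
  have "a - (1/2) *\<^sub>R (a + b) = (1/2) *\<^sub>R (a - b)"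
    by (simp add: algebra_simps flip: scaleR_add_left)
  then show ?thesis
    using assms by (simp add: reflection_def)
qed

lemma inner_bisector:
  fixes a b x :: "'a::real_inner"
  assumes "dist x a = dist x b"
  shows "(x - (1/2) *\<^sub>R (a + b)) \<bullet> (a - b) = 0"
proof -
  have "(x - a) \<bullet> (x - a) = (x - b) \<bullet> (x - b)"
    using assms by (simp add: dist_norm norm_eq_sqrt_inner)
  then show ?thesis
    by (simp add: inner_diff_left inner_diff_right inner_add_left inner_add_right
        inner_commute algebra_simps)
qed

text \<open>
  Points are matched one at a time: the reflection in the perpendicular bisector of the current
  image of a new point and its target fixes all the targets that have already been reached.
\<close>

lemma congruent_families_isometry:
  fixes P Q :: "'i \<Rightarrow> 'a::real_inner"
  assumes "finite I" and "\<And>i j. i \<in> I \<Longrightarrow> j \<in> I \<Longrightarrow> dist (Q i) (Q j) = dist (P i) (P j)"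
  shows "\<exists>T. (\<forall>x y. dist (T x) (T y) = dist x y) \<and> (\<forall>i\<in>I. T (P i) = Q i)"
  using assms
proof (induction I rule: finite_induct)
  case empty
  show ?case by (intro exI[of _ id]) simp
next
  case (insert k I)
  then obtain T where T: "\<And>x y. dist (T x) (T y) = dist x y" "\<And>i. i \<in> I \<Longrightarrow> T (P i) = Q i"
    by (metis insertCI)
  show ?case
  proof (cases "T (P k) = Q k")
    case True
    then show ?thesis using T by blast
  next
    case False
    define R where "R = reflection ((1/2) *\<^sub>R (T (P k) + Q k)) (T (P k) - Q k)"
    have "R (Q i) = Q i" if "i \<in> I" for i
    proof -
      have "dist (Q i) (T (P k)) = dist (Q i) (Q k)"
        using T insert.prems that by (metis insertCI)
      then show ?thesis
        unfolding R_def by (intro reflection_fixes inner_bisector)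
    qed
    moreover have "R (T (P k)) = Q k"
      unfolding R_def using False by (rule reflection_bisector)
    moreover have "dist (R x) (R y) = dist x y" for x y
      by (simp add: R_def dist_reflection)
    ultimately show ?thesis
      using T by (intro exI[of _ "R \<circ> T"]) auto
  qed
qed

lemma proportional_families_similar:
  fixes P Q :: "'i \<Rightarrow> real ^ 2"
  assumes "finite I" and "c > 0"
    and "\<And>i j. i \<in> I \<Longrightarrow> j \<in> I \<Longrightarrow> dist (Q i) (Q j) = c * dist (P i) (P j)"
  shows "\<exists>T. similarity T \<and> (\<forall>i\<in>I. T (P i) = Q i)"
proof -
  have sc: "dist (c *\<^sub>R x) (c *\<^sub>R y) = c * dist x y" for x y :: "real ^ 2"
    using assms(2) by (simp add: dist_norm flip: scaleR_diff_right)
  obtain T where "\<forall>x y. dist (T x) (T y) = dist x y" "\<forall>i\<in>I. T (c *\<^sub>R P i) = Q i"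
    using congruent_families_isometry[OF assms(1), of Q "\<lambda>i. c *\<^sub>R P i"] assms(3)
    by (auto simp: sc)
  then show ?thesis
    using assms(2) sc
    by (intro exI[of _ "\<lambda>x. T (c *\<^sub>R x)"]) (auto simp: similarity_def)
qed

lemma similarity_affine:
  assumes "similarity T" and "(\<Sum>k\<in>I. c k) = 1"
  shows "T (\<Sum>k\<in>I. c k *\<^sub>R x k) = (\<Sum>k\<in>I. c k *\<^sub>R T (x k))"
proof -
  obtain r where r: "r > 0" "\<And>x y. dist (T x) (T y) = r * dist x y"
    using assms(1) by (auto simp: similarity_def)
  \<comment> \<open>Rescaled so as to be an isometry fixing the origin, \<open>T\<close> is linear.\<close>
  define f where "f x = (1 / r) *\<^sub>R (T x - T 0)" for x
  have "dist (f x) (f y) = dist x y" for x y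
  proof -
    have "f x - f y = (1 / r) *\<^sub>R (T x - T y)"
      by (simp add: f_def flip: scaleR_diff_right)
    then show ?thesis
      using r by (simp add: dist_norm)
  qed
  then have "orthogonal_transformation f"
    by (simp add: orthogonal_transformation_isometry f_def)
  then have lin: "linear f"
    by (simp add: orthogonal_transformation_def)
  have T: "T x = r *\<^sub>R f x + T 0" for x
    using r by (simp add: f_def)
  have "T (\<Sum>k\<in>I. c k *\<^sub>R x k) = r *\<^sub>R (\<Sum>k\<in>I. c k *\<^sub>R f (x k)) + (\<Sum>k\<in>I. c k) *\<^sub>R T 0"
    by (subst T) (simp add: linear_sum[OF lin] linear_scale[OF lin] assms(2))
  also have "\<dots> = (\<Sum>k\<in>I. c k *\<^sub>R T (x k))"
    by (subst (2) T) (simp add: scaleR_sum_right scaleR_sum_left scaleR_add_right sum.distrib mult.commute)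
  finally show ?thesis .
qed

lemma similarity_inj: "similarity T \<Longrightarrow> T x = T y \<longleftrightarrow> x = y"
  unfolding similarity_def by (metis dist_eq_0_iff mult_eq_0_iff order_less_irrefl)

section \<open>Barycentric coordinates of least norm\<close>

text \<open>
  \<open>c\<close> is a family of normalized barycentric coordinates of \<open>x\<close> with respect to the points \<open>P k\<close>,
  \<open>k \<in> I\<close>. The values of \<open>c\<close> outside \<open>I\<close> are irrelevant.
\<close>

definition barycentric :: "'i set \<Rightarrow> ('i \<Rightarrow> 'a::real_vector) \<Rightarrow> 'a \<Rightarrow> ('i \<Rightarrow> real) \<Rightarrow> bool" where
  "barycentric I P x c \<longleftrightarrow> (\<Sum>k\<in>I. c k) = 1 \<and> (\<Sum>k\<in>I. c k *\<^sub>R P k) = x"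

text \<open>
  For finite \<open>I\<close> the barycentric coordinates of \<open>x\<close> form a (possibly empty) affine subspace of \<open>\<real>\<^sup>I\<close>.
  Its point of least norm is described here by orthogonality to the directions of that subspace.
\<close>

definition least_barycentric ::
    "'i set \<Rightarrow> ('i \<Rightarrow> 'a::real_vector) \<Rightarrow> 'a \<Rightarrow> ('i \<Rightarrow> real) \<Rightarrow> bool" where
  "least_barycentric I P x c \<longleftrightarrow>
     barycentric I P x c \<and> (\<forall>b. barycentric I P x b \<longrightarrow> (\<Sum>k\<in>I. c k * (b k - c k)) = 0)"

lemma least_barycentric_unique:
  assumes "finite I" "least_barycentric I P x b" "least_barycentric I P x c" "k \<in> I"
  shows "b k = c k"
proof -
  have "(\<Sum>k\<in>I. b k * (c k - b k)) = 0" "(\<Sum>k\<in>I. c k * (b k - c k)) = 0"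
    using assms(2,3) unfolding least_barycentric_def by blast+
  then have "(\<Sum>k\<in>I. b k * (c k - b k) + c k * (b k - c k)) = 0"
    by (simp add: sum.distrib)
  moreover have "b k * (c k - b k) + c k * (b k - c k) = - ((b k - c k)\<^sup>2)" for k
    by (simp add: power2_eq_square algebra_simps)
  ultimately have "(\<Sum>k\<in>I. (b k - c k)\<^sup>2) = 0"
    by (simp add: sum_negf)
  then show ?thesis
    using assms(1,4) by (simp add: sum_nonneg_eq_0_iff)
qed

text \<open>
  The Gram operator \<open>A w = \<Sum>k. (w \<bullet> W k) W k\<close> maps onto the span of the \<open>W k\<close>: if \<open>z\<close> is orthogonal to
  its range, then \<open>0 = z \<bullet> A z = \<Sum>k. (z \<bullet> W k)\<^sup>2\<close>, so \<open>z\<close> is orthogonal to every \<open>W k\<close>.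
\<close>

lemma gram_combination_exists:
  fixes W :: "'i \<Rightarrow> 'a::euclidean_space"
  assumes "finite I" and "b \<in> span (W ` I)"
  shows "\<exists>w. (\<Sum>k\<in>I. (w \<bullet> W k) *\<^sub>R W k) = b"
proof -
  define A where "A w = (\<Sum>k\<in>I. (w \<bullet> W k) *\<^sub>R W k)" for w
  have lin: "linear A"
    by (rule linearI) (simp_all add: A_def inner_add_left scaleR_add_left sum.distrib scaleR_sum_right)
  obtain y z where y: "y \<in> span (range A)" and z: "\<And>w. w \<in> span (range A) \<Longrightarrow> orthogonal z w"
    and b: "b = y + z"
    using orthogonal_subspace_decomp_exists[of "range A" b] by metis
  have span: "span (range A) = range A"
    using lin by (simp add: span_eq_iff linear_subspace_image)
  have Aspan: "A w \<in> span (W ` I)" for w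
    unfolding A_def by (intro span_sum span_scale span_base) simp
  obtain w where w: "y = A w"
    using y unfolding span by blast
  have "z = b - A w"
    using b w by simp
  then have zspan: "z \<in> span (W ` I)"
    using Aspan assms(2) by (simp add: span_diff)
  have "z \<bullet> A z = 0"
    using z[of "A z"] unfolding span by (simp add: orthogonal_def)
  then have "(\<Sum>k\<in>I. (z \<bullet> W k)\<^sup>2) = 0"
    by (simp add: A_def inner_sum_right power2_eq_square)
  then have "\<forall>k\<in>I. z \<bullet> W k = 0"
    using assms(1) by (simp add: sum_nonneg_eq_0_iff)
  then have "orthogonal z z"
    by (intro orthogonal_to_span[OF zspan]) (auto simp: orthogonal_def)
  then have "z = 0"
    by (simp add: orthogonal_self)
  then have "A w = b"
    using b w by simp
  then show ?thesis
    unfolding A_def by blast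
qed

text \<open>
  Barycentric coordinates of \<open>x\<close> are the coefficients of linear combinations of the lifted points
  \<open>(1, P k)\<close> that are equal to \<open>(1, x)\<close>; coordinates of the form \<open>k \<mapsto> w \<bullet> (1, P k)\<close> are
  orthogonal to all directions of the solution space.
\<close>

lemma least_barycentric_exists:
  fixes P :: "'i \<Rightarrow> 'a::euclidean_space"
  assumes "finite I" and "a \<in> I" and "x - P a \<in> span ((\<lambda>k. P k - P a) ` I)"
  shows "\<exists>c. least_barycentric I P x c"
proof -
  define W where "W k = (1::real, P k)" for k
  have "(\<lambda>v. (0::real, v)) ` span ((\<lambda>k. P k - P a) ` I)
      = span ((\<lambda>v. (0, v)) ` (\<lambda>k. P k - P a) ` I)"
    by (rule linear_span_image[symmetric]) (rule linearI; simp)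
  also have "\<dots> \<subseteq> span (W ` I)"
  proof (rule span_minimal)
    show "(\<lambda>v. (0, v)) ` (\<lambda>k. P k - P a) ` I \<subseteq> span (W ` I)"
    proof clarify
      fix k assume "k \<in> I"
      then have "W k - W a \<in> span (W ` I)"
        using assms(2) by (intro span_diff span_base) auto
      then show "(0, P k - P a) \<in> span (W ` I)"
        by (simp add: W_def)
    qed
  qed simp
  finally have "(0, x - P a) \<in> span (W ` I)"
    using assms(3) by blast
  moreover have "W a \<in> span (W ` I)"
    using assms(2) by (intro span_base) simp
  ultimately have "(0, x - P a) + W a \<in> span (W ` I)"
    by (rule span_add)
  then have "(1, x) \<in> span (W ` I)"
    by (simp add: W_def)
  then obtain w where w: "(\<Sum>k\<in>I. (w \<bullet> W k) *\<^sub>R W k) = (1, x)"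
    using gram_combination_exists[OF assms(1)] by metis
  have lift: "barycentric I P x b \<longleftrightarrow> (\<Sum>k\<in>I. b k *\<^sub>R W k) = (1, x)" for b
    by (auto simp: barycentric_def W_def prod_eq_iff fst_sum snd_sum)
  have "(\<Sum>k\<in>I. (w \<bullet> W k) * (b k - w \<bullet> W k)) = 0" if "barycentric I P x b" for b
  proof -
    have "(\<Sum>k\<in>I. (w \<bullet> W k) * (b k - w \<bullet> W k))
        = w \<bullet> ((\<Sum>k\<in>I. b k *\<^sub>R W k) - (\<Sum>k\<in>I. (w \<bullet> W k) *\<^sub>R W k))"
      by (simp add: inner_sum_right inner_diff_right sum_subtractf algebra_simps)
    then show ?thesis
      using that w by (simp add: lift)
  qed
  then have "least_barycentric I P x (\<lambda>k. w \<bullet> W k)"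
    using w by (simp add: least_barycentric_def lift)
  then show ?thesis by blast
qed

lemma barycentric_similarity:
  assumes "similarity T" "\<And>k. k \<in> I \<Longrightarrow> T (P k) = Q k"
  shows "barycentric I Q (T x) c \<longleftrightarrow> barycentric I P x c"
proof -
  have "(\<Sum>k\<in>I. c k *\<^sub>R Q k) = T (\<Sum>k\<in>I. c k *\<^sub>R P k)" if "(\<Sum>k\<in>I. c k) = 1"
    using assms by (simp add: similarity_affine[OF assms(1) that])
  then show ?thesis
    using similarity_inj[OF assms(1)] by (auto simp: barycentric_def)
qed

lemma least_barycentric_similarity:
  assumes "similarity T" "\<And>k. k \<in> I \<Longrightarrow> T (P k) = Q k"
  shows "least_barycentric I Q (T x) c \<longleftrightarrow> least_barycentric I P x c"
  unfolding least_barycentric_def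
  using barycentric_similarity[where T = T and I = I and P = P and Q = Q and x = x] assms by simp

lemma barycentric_permute:
  assumes "p permutes I" and "\<And>k. k \<in> I \<Longrightarrow> Q k = P (p k)"
  shows "barycentric I Q x (\<lambda>k. c (p k)) \<longleftrightarrow> barycentric I P x c"
proof -
  have "(\<Sum>k\<in>I. c (p k)) = (\<Sum>k\<in>I. c k)"
    using sum.permute[OF assms(1), of c] by (simp add: o_def)
  moreover have "(\<Sum>k\<in>I. c (p k) *\<^sub>R Q k) = (\<Sum>k\<in>I. c k *\<^sub>R P k)"
    using sum.permute[OF assms(1), of "\<lambda>k. c k *\<^sub>R P k"] assms(2) by (simp add: o_def)
  ultimately show ?thesis by (simp add: barycentric_def)
qed

lemma least_barycentric_permute:
  assumes "p permutes I" and "\<And>k. k \<in> I \<Longrightarrow> Q k = P (p k)" and "least_barycentric I P x c"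
  shows "least_barycentric I Q x (\<lambda>k. c (p k))"
  unfolding least_barycentric_def
proof (intro conjI allI impI)
  show "barycentric I Q x (\<lambda>k. c (p k))"
    using assms by (simp add: barycentric_permute least_barycentric_def)
next
  fix b assume b: "barycentric I Q x b"
  define b' where "b' k = b (inv' p k)" for k
  have bp: "b = (\<lambda>k. b' (p k))"
    using assms(1) by (simp add: b'_def permutes_inverses)
  then have "barycentric I P x b'"
    using b barycentric_permute[where p = p and I = I and P = P and Q = Q and x = x and c = b'] assms(1,2)
    by simp
  then have "(\<Sum>k\<in>I. c k * (b' k - c k)) = 0"
    using assms(3) by (simp add: least_barycentric_def)
  then show "(\<Sum>k\<in>I. c (p k) * (b k - c (p k))) = 0"
    using sum.permute[OF assms(1), of "\<lambda>k. c k * (b' k - c k)"] by (simp add: o_def bp)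
qed

section \<open>The dihedral group\<close>

lemma rho_eq: "n \<ge> 1 \<Longrightarrow> i \<in> {1..n} \<Longrightarrow> rho n i = (if i = n then 1 else i + 1)"
  by (cases "n = 1") (auto simp: rho_def cyc_def mod_Suc)

lemma sigma_eq: "n \<ge> 2 \<Longrightarrow> i \<in> {1..n} \<Longrightarrow> sigma n i = (if i = 1 then 1 else n + 2 - i)"
proof -
  assume n: "n \<ge> 2" "i \<in> {1..n}"
  consider "i = 1" | "i = 2" | "i > 2" using n by fastforce
  then show ?thesis
    by cases (use n in \<open>auto simp: sigma_def cyc_def mod_Suc\<close>)
qed

text \<open>The defining relation of the dihedral group, in a form free of inverses.\<close>

lemma rho_sigma_rho:
  assumes "n \<ge> 2"
  shows "rho n (sigma n (rho n i)) = sigma n i"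
proof (cases "i \<in> {1..n}")
  case True
  then consider "i = 1" "i < n" | "i = n" | "1 < i" "i < n"
    using assms by fastforce
  then show ?thesis
  proof cases
    case 3
    then have "sigma n (rho n i) = n + 1 - i" "sigma n i = n + 2 - i"
      using assms by (simp_all add: rho_eq sigma_eq)
    then show ?thesis
      using 3 assms rho_eq[of n "n + 1 - i"] by (simp add: Suc_le_eq Suc_diff_le)
  qed (use assms in \<open>simp_all add: rho_eq sigma_eq\<close>)
qed (auto simp: rho_def sigma_def)

lemma rho_funpow:
  assumes "n \<ge> 1" "i \<in> {1..n}" "l \<le> n"
  shows "(rho n ^^ l) i = (if i + l \<le> n then i + l else i + l - n)"
  using assms(3)
proof (induction l)
  case (Suc l)
  then have IH: "(rho n ^^ l) i = (if i + l \<le> n then i + l else i + l - n)"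
    by simp
  have "(rho n ^^ l) i \<in> {1..n}"
    using assms(2) Suc.prems unfolding IH by auto
  from rho_eq[OF assms(1) this] show ?case
    using assms(2) Suc.prems by (auto simp: IH)
qed (use assms in auto)

lemma rho_funpow_n: "n \<ge> 1 \<Longrightarrow> (rho n ^^ n) i = i"
proof (cases "i \<in> {1..n}")
  case False
  have "(rho n ^^ l) i = i" for l
    using False by (induction l) (auto simp: rho_def)
  then show ?thesis .
qed (simp add: rho_funpow)

lemma sigma_sigma:
  assumes "n \<ge> 2"
  shows "sigma n (sigma n i) = i"
proof (cases "i \<in> {1..n}")
  case True
  then consider "i = 1" | "i \<noteq> 1" "n + 2 - i \<in> {1..n}" "n + 2 - i \<noteq> 1"
    using assms by fastforce
  then show ?thesis
    by cases (use True assms in \<open>simp_all add: sigma_eq del: atLeastAtMost_iff\<close>, use True in simp)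
qed (auto simp: sigma_def)

lemma rho_permutes:
  assumes "n \<ge> 1"
  shows "rho n permutes {1..n}"
proof -
  obtain m where m: "n = Suc m" using assms by (cases n) auto
  have "(rho n ^^ m) (rho n i) = i" "rho n ((rho n ^^ m) i) = i" for i
    using rho_funpow_n[OF assms, of i] by (simp_all add: m funpow_swap1)
  then have "bij (rho n)"
    by (intro o_bij[of "rho n ^^ m"]) auto
  then show ?thesis
    by (auto simp: permutes_def bij_iff rho_def)
qed

lemma sigma_permutes:
  assumes "n \<ge> 2"
  shows "sigma n permutes {1..n}"
proof -
  have "bij (sigma n)"
    using sigma_sigma[OF assms] by (intro o_bij[of "sigma n"]) auto
  then show ?thesis
    by (auto simp: permutes_def bij_iff sigma_def)
qed

lemma sigma_rho_funpow:
  assumes "n \<ge> 2" "l \<le> n"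
  shows "sigma n ((rho n ^^ l) i) = (rho n ^^ (n - l)) (sigma n i)"
proof -
  \<comment> \<open>\<open>\<rho>\<^sup>l \<sigma> \<rho>\<^sup>l = \<sigma>\<close>; applying \<open>\<rho>\<^sup>n\<^sup>-\<^sup>l\<close> gives the claim, as \<open>\<rho>\<^sup>n\<close> is the identity.\<close>
  have *: "(rho n ^^ l) (sigma n ((rho n ^^ l) i)) = sigma n i" for l i
  proof (induction l arbitrary: i)
    case (Suc l)
    have "(rho n ^^ Suc l) (sigma n ((rho n ^^ Suc l) i))
        = (rho n ^^ l) (rho n (sigma n (rho n ((rho n ^^ l) i))))"
      by (simp add: funpow_swap1)
    then show ?case
      using Suc by (simp add: rho_sigma_rho[OF assms(1)])
  qed simp
  have "sigma n ((rho n ^^ l) i) = (rho n ^^ (n - l + l)) (sigma n ((rho n ^^ l) i))"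
    using assms by (simp add: rho_funpow_n)
  also have "\<dots> = (rho n ^^ (n - l)) (sigma n i)"
    by (simp add: funpow_add *)
  finally show ?thesis .
qed

lemma dihedral_rho_funpow: "rho n ^^ l \<in> dihedral n"
proof (induction l)
  case 0
  show ?case
    using generate.one[of "sym_group n" "{rho n, sigma n}"]
    by (simp add: dihedral_def sym_group_one id_def)
next
  case (Suc l)
  have "rho n \<in> dihedral n"
    unfolding dihedral_def by (rule generate.incl) simp
  then show ?case
    using Suc generate.eng[of "rho n" "sym_group n" _ "rho n ^^ l"]
    unfolding dihedral_def sym_group_mult funpow.simps by blast
qed

lemma dihedral_sigma: "sigma n \<in> dihedral n"
  unfolding dihedral_def by (rule generate.incl) simp

lemma dihedral_permutes:
  assumes "n \<ge> 2" "\<alpha> \<in> dihedral n"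
  shows "\<alpha> permutes {1..n}"
proof -
  have "generate (sym_group n) {rho n, sigma n} \<subseteq> carrier (sym_group n)"
    using assms(1) rho_permutes[of n] sigma_permutes[of n]
    by (intro group.generate_incl[OF sym_group_is_group]) (simp add: sym_group_carrier)
  then show ?thesis
    using assms(2) by (auto simp: dihedral_def sym_group_carrier)
qed

section \<open>Relabelled polygons and their distance matrices\<close>

text \<open>The polygon whose \<open>i\<close>-th vertex is the \<open>\<alpha> i\<close>-th vertex of \<open>P\<close>.\<close>

definition relabel :: "nat \<Rightarrow> (nat \<Rightarrow> nat) \<Rightarrow> (nat \<Rightarrow> 'a) \<Rightarrow> nat \<Rightarrow> 'a" where
  "relabel n \<alpha> P = (\<lambda>i\<in>{1..n}. P (\<alpha> i))"

lemma relabel_in_ngons: "relabel n \<alpha> P \<in> ngons n"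
  by (simp add: relabel_def ngons_def)

lemma map_ngon_in_ngons: "map_ngon n T P \<in> ngons n"
  by (simp add: map_ngon_def ngons_def)

lemma ngon_eqI: "P \<in> ngons n \<Longrightarrow> Q \<in> ngons n \<Longrightarrow> (\<And>i. i \<in> {1..n} \<Longrightarrow> P i = Q i) \<Longrightarrow> P = Q"
  unfolding ngons_def by (rule PiE_ext)

lemma closed_family_ngons: "closed_family n F \<Longrightarrow> P \<in> F \<Longrightarrow> P \<in> ngons n"
  unfolding closed_family_def by blast

lemma ngon_center_closed_family: "ngon_center n F \<Phi> \<Longrightarrow> closed_family n F"
  unfolding ngon_center_def by blast

lemma relabel_in_family:
  assumes "closed_family n F" "P \<in> F" "\<alpha> \<in> dihedral n"
  shows "relabel n \<alpha> P \<in> F"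
proof -
  have "differ_only_in_labelling n P (relabel n \<alpha> P)"
    unfolding differ_only_in_labelling_def relabel_def by (intro bexI[OF _ assms(3)]) simp
  then show ?thesis
    using assms(1,2) relabel_in_ngons[of n \<alpha> P] unfolding closed_family_def by blast
qed

lemma map_ngon_in_family:
  assumes "closed_family n F" "P \<in> F" "similarity T"
  shows "map_ngon n T P \<in> F"
proof -
  have "similar_ngons n P (map_ngon n T P)"
    unfolding map_ngon_def similar_ngons_def by (intro exI[of _ T]) (simp add: assms(3))
  then show ?thesis
    using assms(1,2) map_ngon_in_ngons[of n T P] unfolding closed_family_def by blast
qed

lemma ngon_center_relabel:
  assumes "ngon_center n F \<Phi>" "P \<in> F" "\<alpha> \<in> dihedral n"
  shows "\<Phi> (relabel n \<alpha> P) = \<Phi> P"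
proof -
  have "differ_only_in_labelling n P (relabel n \<alpha> P)"
    using assms(3) by (auto simp: relabel_def differ_only_in_labelling_def)
  moreover have "relabel n \<alpha> P \<in> F"
    by (rule relabel_in_family[OF ngon_center_closed_family[OF assms(1)] assms(2,3)])
  ultimately show ?thesis
    using assms(1,2) unfolding ngon_center_def by metis
qed

lemma matrix_on_apply: "i \<in> {1..n} \<Longrightarrow> j \<in> {1..n} \<Longrightarrow> matrix_on n a i j = a i j"
  by (simp add: matrix_on_def)

lemma matrix_on_eq_iff:
  "matrix_on n a = matrix_on n b \<longleftrightarrow> (\<forall>i\<in>{1..n}. \<forall>j\<in>{1..n}. a i j = b i j)"
proof
  assume eq: "matrix_on n a = matrix_on n b"
  show "\<forall>i\<in>{1..n}. \<forall>j\<in>{1..n}. a i j = b i j"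
    using matrix_on_apply eq by metis
qed (auto simp: matrix_on_def fun_eq_iff restrict_def)

lemma permute_dist_matrix:
  assumes "\<alpha> permutes {1..n}"
  shows "permute_matrix n \<alpha> (dist_matrix n P) = dist_matrix n (relabel n \<alpha> P)"
proof -
  have "\<alpha> i \<in> {1..n}" if "i \<in> {1..n}" for i
    using that permutes_in_image[OF assms] by blast
  then show ?thesis
    unfolding permute_matrix_def dist_matrix_def matrix_on_eq_iff
    by (simp add: relabel_def matrix_on_apply del: atLeastAtMost_iff)
qed

lemma dist_matrix_map_ngon:
  assumes "\<And>x y. dist (T x) (T y) = r * dist x y"
  shows "dist_matrix n (map_ngon n T P) = scale_matrix n r (dist_matrix n P)"
  unfolding scale_matrix_def dist_matrix_def matrix_on_eq_iff
  using assms by (simp add: map_ngon_def matrix_on_apply del: atLeastAtMost_iff)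

lemma proportional_dist_matrix_similar:
  assumes "dist_matrix n Q = scale_matrix n c (dist_matrix n P)" "c > 0" "Q \<in> ngons n"
  shows "\<exists>T. similarity T \<and> Q = map_ngon n T P"
proof -
  have "\<forall>i\<in>{1..n}. \<forall>j\<in>{1..n}. dist (Q i) (Q j) = c * dist (P i) (P j)"
    using assms(1) unfolding dist_matrix_def scale_matrix_def matrix_on_eq_iff
    by (simp add: matrix_on_apply del: atLeastAtMost_iff)
  then obtain T where "similarity T" "\<forall>i\<in>{1..n}. T (P i) = Q i"
    using proportional_families_similar[of "{1..n}" c Q P] assms(2) by auto
  moreover from this have "Q = map_ngon n T P"
    by (intro ngon_eqI[OF assms(3) map_ngon_in_ngons]) (simp add: map_ngon_def)
  ultimately show ?thesis by blast
qed

section \<open>From a center to a center function\<close>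

text \<open>
  The component \<open>v\<close> of \<open>\<Phi> P - P a\<close> orthogonal to all the \<open>P k - P a\<close> is a normal vector of a
  reflection that fixes \<open>P\<close>, and hence \<open>\<Phi> P\<close>. This forces \<open>v = 0\<close>.
\<close>

lemma ngon_center_in_affine_span:
  assumes "ngon_center n F \<Phi>" "P \<in> F"
  shows "\<Phi> P - P a \<in> span ((\<lambda>k. P k - P a) ` {1..n})"
proof -
  define S where "S = (\<lambda>k. P k - P a) ` {1..n}"
  obtain y v where y: "y \<in> span S" and v: "\<And>w. w \<in> span S \<Longrightarrow> orthogonal v w"
    and eq: "\<Phi> P - P a = y + v"
    using orthogonal_subspace_decomp_exists[of S "\<Phi> P - P a"] by metis
  define T where "T = reflection (P a) v"
  have T_fix: "T (P k) = P k" if "k \<in> {1..n}" for k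
  proof -
    have "orthogonal v (P k - P a)"
      using that by (intro v span_base) (auto simp: S_def)
    then show ?thesis
      unfolding T_def by (intro reflection_fixes) (simp add: orthogonal_def inner_commute)
  qed
  have T: "similarity T"
    unfolding similarity_def by (intro exI[of _ 1]) (simp add: T_def dist_reflection)
  have "P \<in> ngons n"
    using closed_family_ngons ngon_center_closed_family assms by blast
  with map_ngon_in_ngons have "map_ngon n T P = P"
    by (rule ngon_eqI) (simp add: map_ngon_def T_fix)
  then have "T (\<Phi> P) = \<Phi> P"
    using assms T unfolding ngon_center_def by metis
  moreover have "(\<Phi> P - P a) \<bullet> v = v \<bullet> v"
    using v[OF y] by (simp add: eq inner_add_left orthogonal_def inner_commute[of y v])
  ultimately have "v = 0"
    by (auto simp: T_def reflection_def split: if_splits)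
  then show ?thesis
    using y eq by (simp add: S_def)
qed

lemma ngon_center_least_barycentric_exists:
  assumes "ngon_center n F \<Phi>" "P \<in> F" "n \<ge> 1"
  shows "\<exists>c. least_barycentric {1..n} P (\<Phi> P) c"
  using least_barycentric_exists[of "{1..n}" 1 "\<Phi> P" P]
    ngon_center_in_affine_span[OF assms(1,2), of 1] assms(3) by auto

text \<open>
  The least-norm coordinates of the center depend only on the ratios of the distances between the
  vertices.
\<close>

lemma ngon_center_least_barycentric_similar:
  assumes "ngon_center n F \<Phi>" "P \<in> F" "Q \<in> F" "c > 0"
    and "dist_matrix n Q = scale_matrix n c (dist_matrix n P)"
  shows "least_barycentric {1..n} Q (\<Phi> Q) b \<longleftrightarrow> least_barycentric {1..n} P (\<Phi> P) b"
proof -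
  have "Q \<in> ngons n"
    using closed_family_ngons ngon_center_closed_family assms(1,3) by blast
  then obtain T where T: "similarity T" "Q = map_ngon n T P"
    using proportional_dist_matrix_similar[OF assms(5,4)] by blast
  have "\<Phi> Q = T (\<Phi> P)"
    using assms(1,2) T unfolding ngon_center_def by blast
  then show ?thesis
    using least_barycentric_similarity[OF T(1), of "{1..n}" P Q "\<Phi> P"] T(2)
    by (simp add: map_ngon_def)
qed

text \<open>
  The value at the distance matrix of \<open>P\<close> is the first of the least-norm barycentric coordinates of
  \<open>\<Phi> P\<close> with respect to \<open>P\<close>. For a center \<open>\<Phi>\<close> it does not depend on the choice of \<open>P\<close>:
  see \<open>first_weight_eq\<close>.
\<close>

definition first_weight ::
    "nat \<Rightarrow> (nat \<Rightarrow> real ^ 2) set \<Rightarrow> ((nat \<Rightarrow> real ^ 2) \<Rightarrow> real ^ 2) \<Rightarrow> (nat \<Rightarrow> nat \<Rightarrow> real) \<Rightarrow> real"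
  where "first_weight n F \<Phi> d =
    (SOME t. \<exists>P\<in>F. \<exists>c. dist_matrix n P = d \<and> least_barycentric {1..n} P (\<Phi> P) c \<and> t = c 1)"

lemma first_weight_eq:
  assumes "ngon_center n F \<Phi>" "P \<in> F" "n \<ge> 1" "c > 0"
    and "least_barycentric {1..n} P (\<Phi> P) b"
  shows "first_weight n F \<Phi> (scale_matrix n c (dist_matrix n P)) = b 1"
  unfolding first_weight_def
proof (rule some_equality)
  define Q where "Q = map_ngon n (\<lambda>x. c *\<^sub>R x) P"
  have sc: "dist (c *\<^sub>R x) (c *\<^sub>R y) = c * dist x y" for x y :: "real ^ 2"
    using assms(4) by (simp add: dist_norm flip: scaleR_diff_right)
  have "similarity (\<lambda>x. c *\<^sub>R x)"
    using assms(4) sc by (auto simp: similarity_def)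
  then have "Q \<in> F"
    unfolding Q_def by (intro map_ngon_in_family[OF ngon_center_closed_family[OF assms(1)] assms(2)])
  moreover have "dist_matrix n Q = scale_matrix n c (dist_matrix n P)"
    unfolding Q_def by (rule dist_matrix_map_ngon) (rule sc)
  moreover from calculation have "least_barycentric {1..n} Q (\<Phi> Q) b"
    using ngon_center_least_barycentric_similar assms by blast
  ultimately show "\<exists>Q\<in>F. \<exists>a. dist_matrix n Q = scale_matrix n c (dist_matrix n P) \<and>
      least_barycentric {1..n} Q (\<Phi> Q) a \<and> b 1 = a 1" by blast
next
  fix t
  assume "\<exists>Q\<in>F. \<exists>a. dist_matrix n Q = scale_matrix n c (dist_matrix n P) \<and>
      least_barycentric {1..n} Q (\<Phi> Q) a \<and> t = a 1"
  then obtain a where "least_barycentric {1..n} P (\<Phi> P) a" "t = a 1"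
    using ngon_center_least_barycentric_similar[OF assms(1,2) _ assms(4)] by blast
  then show "t = b 1"
    using least_barycentric_unique[OF _ _ assms(5)] assms(3) by auto
qed

lemma scale_matrix_1_dist: "scale_matrix n 1 (dist_matrix n P) = dist_matrix n P"
  unfolding scale_matrix_def dist_matrix_def matrix_on_eq_iff
  by (simp add: matrix_on_apply del: atLeastAtMost_iff)

lemma first_weight_permute:
  assumes "ngon_center n F \<Phi>" "P \<in> F" "n \<ge> 2" "\<alpha> \<in> dihedral n"
    and "least_barycentric {1..n} P (\<Phi> P) b"
  shows "first_weight n F \<Phi> (permute_matrix n \<alpha> (dist_matrix n P)) = b (\<alpha> 1)"
proof -
  define Q where "Q = relabel n \<alpha> P"
  have \<alpha>: "\<alpha> permutes {1..n}"
    using dihedral_permutes assms(3,4) by blast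
  have "Q \<in> F"
    unfolding Q_def by (rule relabel_in_family[OF ngon_center_closed_family[OF assms(1)] assms(2,4)])
  moreover have "\<Phi> Q = \<Phi> P"
    using ngon_center_relabel assms unfolding Q_def by blast
  moreover have "least_barycentric {1..n} Q (\<Phi> P) (\<lambda>k. b (\<alpha> k))"
    using \<alpha> _ assms(5) by (rule least_barycentric_permute) (simp add: Q_def relabel_def)
  ultimately have "first_weight n F \<Phi> (scale_matrix n 1 (dist_matrix n Q)) = b (\<alpha> 1)"
    using assms(1,3) by (intro first_weight_eq) auto
  then show ?thesis
    by (simp add: scale_matrix_1_dist permute_dist_matrix[OF \<alpha>] Q_def)
qed

lemma first_weight_center_function:
  assumes "ngon_center n F \<Phi>" "n \<ge> 2"
  shows "ngon_center_function n F (first_weight n F \<Phi>)"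
  unfolding ngon_center_function_def projection_def
proof (intro conjI ballI exI[of _ 0] allI impI)
  fix d assume "d \<in> dist_matrix n ` F"
  then obtain P b where P: "P \<in> F" "d = dist_matrix n P" "least_barycentric {1..n} P (\<Phi> P) b"
    using ngon_center_least_barycentric_exists[OF assms(1)] assms(2) by fastforce
  have d: "first_weight n F \<Phi> (scale_matrix n c d) = b 1" if "c > 0" for c
    using first_weight_eq[OF assms(1) P(1) _ that P(3)] assms(2) P(2) by simp
  have "first_weight n F \<Phi> d = b 1"
    using d[of 1] P(2) by (simp add: scale_matrix_1_dist)
  moreover have "sigma n 1 = 1"
    using assms(2) by (simp add: sigma_eq)
  ultimately show "first_weight n F \<Phi> d = first_weight n F \<Phi> (permute_matrix n (sigma n) d)"
    using first_weight_permute[OF assms(1) P(1) assms(2) dihedral_sigma P(3)] P(2) by simp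
  fix c :: real assume "c > 0"
  show "first_weight n F \<Phi> (scale_matrix n c d) = c ^ 0 * first_weight n F \<Phi> d"
    using d[OF \<open>c > 0\<close>] \<open>first_weight n F \<Phi> d = b 1\<close> by simp
qed

section \<open>From a center function to a center\<close>

text \<open>The weight that \<open>g\<close> gives to the vertex with label \<open>l + 1\<close>, before normalization.\<close>

definition weight ::
    "nat \<Rightarrow> ((nat \<Rightarrow> nat \<Rightarrow> real) \<Rightarrow> real) \<Rightarrow> (nat \<Rightarrow> real ^ 2) \<Rightarrow> nat \<Rightarrow> real" where
  "weight n g P l = g (permute_matrix n (rho n ^^ l) (dist_matrix n P))"

lemma weight_eq:
  assumes "n \<ge> 2"
  shows "weight n g P l = g (dist_matrix n (relabel n (rho n ^^ l) P))"
  unfolding weight_def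
  using permute_dist_matrix dihedral_permutes[OF assms dihedral_rho_funpow] by metis

text \<open>
  The right-hand side of the formula for \<open>\<Phi> P\<close>. The vertex with label \<open>l + 1\<close> is written as
  \<open>P (\<rho>\<^sup>l 1)\<close>, which makes the summands periodic in \<open>l\<close> with period \<open>n\<close>.
\<close>

definition weighted_mean ::
    "nat \<Rightarrow> ((nat \<Rightarrow> nat \<Rightarrow> real) \<Rightarrow> real) \<Rightarrow> (nat \<Rightarrow> real ^ 2) \<Rightarrow> real ^ 2" where
  "weighted_mean n g P =
    (1 / (\<Sum>l<n. weight n g P l)) *\<^sub>R (\<Sum>l<n. weight n g P l *\<^sub>R P ((rho n ^^ l) 1))"

lemma weighted_mean_eq:
  assumes "n \<ge> 1"
  shows "(\<Sum>k=1..n. (weight n g P (k - 1) / (\<Sum>l<n. weight n g P l)) *\<^sub>R P k) = weighted_mean n g P"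
proof -
  have "(\<Sum>k=1..n. (weight n g P (k - 1) / S) *\<^sub>R P k)
      = (\<Sum>l<n. (weight n g P l / S) *\<^sub>R P ((rho n ^^ l) 1))" for S
  proof (rule sum.reindex_bij_witness[of _ Suc "\<lambda>k. k - 1"])
    fix k assume "k \<in> {1..n}"
    then show "(weight n g P (k - 1) / S) *\<^sub>R P ((rho n ^^ (k - 1)) 1)
        = (weight n g P (k - 1) / S) *\<^sub>R P k"
      by (subst rho_funpow) auto
  qed auto
  then show ?thesis
    by (simp add: weighted_mean_def scaleR_sum_right)
qed

lemma weighted_mean_similarity:
  assumes g: "ngon_center_function n F g" and F: "closed_family n F" "P \<in> F" "n \<ge> 2"
    and T: "similarity T" and nz: "(\<Sum>l<n. weight n g P l) \<noteq> 0"
  shows "weighted_mean n g (map_ngon n T P) = T (weighted_mean n g P)"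
proof -
  obtain r where r: "r > 0" "\<And>x y. dist (T x) (T y) = r * dist x y"
    using T by (auto simp: similarity_def)
  obtain m where m: "\<And>c d. c > 0 \<Longrightarrow> d \<in> projection n F \<Longrightarrow> g (scale_matrix n c d) = c ^ m * g d"
    using g unfolding ngon_center_function_def by blast
  define Q where "Q = map_ngon n T P"
  define S where "S = (\<Sum>l<n. weight n g P l)"
  have rho: "(rho n ^^ l) i \<in> {1..n} \<longleftrightarrow> i \<in> {1..n}" for l i
    using permutes_in_image[OF dihedral_permutes[OF F(3) dihedral_rho_funpow]] .
  have w: "weight n g Q l = r ^ m * weight n g P l" for l
  proof -
    have "relabel n (rho n ^^ l) Q = map_ngon n T (relabel n (rho n ^^ l) P)"
      using rho[of l] by (auto simp: Q_def relabel_def map_ngon_def fun_eq_iff)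
    moreover have "dist_matrix n (relabel n (rho n ^^ l) P) \<in> projection n F"
      unfolding projection_def using relabel_in_family[OF F(1,2) dihedral_rho_funpow] by blast
    ultimately show ?thesis
      by (simp add: weight_eq[OF F(3)] dist_matrix_map_ngon[OF r(2)] m r(1))
  qed
  have Q: "Q ((rho n ^^ l) (Suc 0)) = T (P ((rho n ^^ l) (Suc 0)))" for l
    using rho[of l 1] F(3) by (simp add: Q_def map_ngon_def)
  have mean: "weighted_mean n g P = (\<Sum>l<n. (weight n g P l / S) *\<^sub>R P ((rho n ^^ l) 1))"
    by (simp add: weighted_mean_def S_def scaleR_sum_right)
  have "(\<Sum>l<n. weight n g P l / S) = 1"
    using nz by (simp add: S_def flip: sum_divide_distrib)
  then have "T (weighted_mean n g P) = (\<Sum>l<n. (weight n g P l / S) *\<^sub>R T (P ((rho n ^^ l) 1)))"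
    unfolding mean by (rule similarity_affine[OF T])
  moreover have "(\<Sum>l<n. weight n g Q l) = r ^ m * S"
    by (simp add: w S_def sum_distrib_left)
  then have "weighted_mean n g Q = (\<Sum>l<n. (weight n g P l / S) *\<^sub>R T (P ((rho n ^^ l) 1)))"
    using r(1) by (simp add: weighted_mean_def w Q scaleR_sum_right)
  ultimately show ?thesis by (simp add: Q_def)
qed

lemma sum_periodic_shift:
  fixes f :: "nat \<Rightarrow> 'a::comm_monoid_add"
  assumes "f n = f 0"
  shows "(\<Sum>l<n. f (Suc l)) = (\<Sum>l<n. f l)"
proof (cases n)
  case (Suc m)
  have "(\<Sum>l<n. f (Suc l)) = (\<Sum>l<m. f (Suc l)) + f 0"
    using assms Suc by simp
  also have "\<dots> = (\<Sum>l<n. f l)"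
    unfolding Suc sum.lessThan_Suc_shift by (rule add.commute)
  finally show ?thesis .
qed simp

lemma sum_periodic_reverse:
  fixes f :: "nat \<Rightarrow> 'a::comm_monoid_add"
  assumes "f n = f 0"
  shows "(\<Sum>l<n. f (n - l)) = (\<Sum>l<n. f l)"
proof -
  have "(\<Sum>l<n. f (n - l)) = (\<Sum>l<n. f (Suc (n - Suc l)))"
    by (intro sum.cong) (auto simp: Suc_diff_Suc)
  also have "\<dots> = (\<Sum>l<n. f (Suc l))"
    by (rule sum.nat_diff_reindex[of "\<lambda>l. f (Suc l)"])
  finally show ?thesis
    using sum_periodic_shift[of f, OF assms] by simp
qed

lemma weight_n: "n \<ge> 1 \<Longrightarrow> weight n g P n = weight n g P 0"
  by (simp add: weight_def permute_matrix_def rho_funpow_n)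

lemma weighted_mean_rho:
  assumes "n \<ge> 2"
  shows "weighted_mean n g (relabel n (rho n) P) = weighted_mean n g P"
proof -
  have n1: "n \<ge> 1" using assms by simp
  have rho: "(rho n ^^ l) i \<in> {1..n} \<longleftrightarrow> i \<in> {1..n}" for l i
    using permutes_in_image[OF dihedral_permutes[OF assms dihedral_rho_funpow]] .
  have w: "weight n g (relabel n (rho n) P) l = weight n g P (Suc l)" for l
  proof -
    have "relabel n (rho n ^^ l) (relabel n (rho n) P) = relabel n (rho n ^^ Suc l) P"
      using rho[of l] by (auto simp: relabel_def fun_eq_iff)
    then show ?thesis by (simp add: weight_eq[OF assms])
  qed
  have "relabel n (rho n) P ((rho n ^^ l) 1) = P ((rho n ^^ Suc l) 1)" for l
    using rho[of l 1] n1 by (simp add: relabel_def)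
  then show ?thesis
    using sum_periodic_shift[of "weight n g P" n]
      sum_periodic_shift[of "\<lambda>l. weight n g P l *\<^sub>R P ((rho n ^^ l) 1)" n]
    by (simp add: weighted_mean_def w weight_n[OF n1] rho_funpow_n[OF n1] del: funpow.simps)
qed

text \<open>
  Relabelling by \<open>\<sigma>\<close> exchanges the summands \<open>l\<close> and \<open>n - l\<close>, since \<open>\<sigma> \<rho>\<^sup>l = \<rho>\<^sup>n\<^sup>-\<^sup>l \<sigma>\<close> and \<open>\<sigma> 1 = 1\<close>.
\<close>

lemma weighted_mean_sigma:
  assumes g: "ngon_center_function n F g" and F: "closed_family n F" "P \<in> F" "n \<ge> 2"
  shows "weighted_mean n g (relabel n (sigma n) P) = weighted_mean n g P"
proof -
  have n1: "n \<ge> 1" using F(3) by simp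
  have rho: "(rho n ^^ l) i \<in> {1..n} \<longleftrightarrow> i \<in> {1..n}" for l i
    using permutes_in_image[OF dihedral_permutes[OF F(3) dihedral_rho_funpow]] .
  have sigma: "sigma n i \<in> {1..n} \<longleftrightarrow> i \<in> {1..n}" for i
    using permutes_in_image[OF sigma_permutes[OF F(3)]] .
  have w: "weight n g (relabel n (sigma n) P) l = weight n g P (n - l)" if "l \<le> n" for l
  proof -
    define R where "R = relabel n (rho n ^^ (n - l)) P"
    have "relabel n (rho n ^^ l) (relabel n (sigma n) P) = relabel n (sigma n) R"
      using rho[of l] sigma
      by (auto simp: R_def relabel_def fun_eq_iff sigma_rho_funpow[OF F(3) that])
    moreover have "dist_matrix n R \<in> projection n F"
      unfolding projection_def R_def
      using relabel_in_family[OF F(1,2) dihedral_rho_funpow] by blast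
    then have "g (dist_matrix n R) = g (dist_matrix n (relabel n (sigma n) R))"
      using g permute_dist_matrix[OF sigma_permutes[OF F(3)]]
      unfolding ngon_center_function_def by metis
    ultimately show ?thesis
      by (simp add: weight_eq[OF F(3)] R_def)
  qed
  have pt: "relabel n (sigma n) P ((rho n ^^ l) (Suc 0)) = P ((rho n ^^ (n - l)) (Suc 0))" if "l \<le> n" for l
  proof -
    have "sigma n 1 = 1" using F(3) by (simp add: sigma_eq)
    then show ?thesis
      using rho[of l 1] n1 sigma_rho_funpow[OF F(3) that, of 1] by (simp add: relabel_def)
  qed
  show ?thesis
    using sum_periodic_reverse[of "weight n g P" n]
      sum_periodic_reverse[of "\<lambda>l. weight n g P l *\<^sub>R P ((rho n ^^ l) 1)" n]
    by (simp add: weighted_mean_def w pt weight_n[OF n1] rho_funpow_n[OF n1])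
qed

text \<open>
  Invariance under an inverse \<open>h\<inverse>\<close> follows from invariance under \<open>h\<close> at the polygon relabelled by
  \<open>h\<inverse>\<close>, which again lies in the family.
\<close>

lemma dihedral_invariant:
  fixes \<Phi> :: "(nat \<Rightarrow> real ^ 2) \<Rightarrow> 'b"
  assumes F: "closed_family n F" "n \<ge> 2"
    and gen: "\<And>P \<tau>. P \<in> F \<Longrightarrow> \<tau> \<in> {rho n, sigma n} \<Longrightarrow> \<Phi> (relabel n \<tau> P) = \<Phi> P"
    and "\<alpha> \<in> dihedral n" "P \<in> F"
  shows "\<Phi> (relabel n \<alpha> P) = \<Phi> P"
proof -
  have ext: "relabel n id P = P" if "P \<in> F" for P
    by (rule ngon_eqI[OF relabel_in_ngons closed_family_ngons[OF F(1) that]]) (simp add: relabel_def)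
  have comp: "relabel n (\<beta> \<circ> \<gamma>) P = relabel n \<gamma> (relabel n \<beta> P)" if "\<gamma> \<in> dihedral n" for \<beta> \<gamma> P
    using permutes_in_image[OF dihedral_permutes[OF F(2) that]]
    by (auto simp: relabel_def fun_eq_iff)
  from assms(4,5) show ?thesis
    unfolding dihedral_def
  proof (induction arbitrary: P)
    case one
    then show ?case by (simp only: sym_group_one ext)
  next
    case (incl h)
    then show ?case using gen by blast
  next
    case (inv h)
    have h: "h \<in> dihedral n"
      unfolding dihedral_def using inv by (intro generate.incl)
    have h': "inv\<^bsub>sym_group n\<^esub> h \<in> dihedral n"
      unfolding dihedral_def using inv by (intro generate.inv)
    have hp: "h permutes {1..n}"
      using dihedral_permutes[OF F(2) h] .
    define R where "R = relabel n (inv\<^bsub>sym_group n\<^esub> h) P"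
    have "inv\<^bsub>sym_group n\<^esub> h \<circ> h = id"
      using group.l_inv[OF sym_group_is_group, of h n] hp
      by (simp add: sym_group_carrier sym_group_mult sym_group_one)
    then have "relabel n h R = P"
      using comp[OF h, of "inv\<^bsub>sym_group n\<^esub> h" P] ext inv.prems by (simp add: R_def)
    moreover have "R \<in> F"
      unfolding R_def by (rule relabel_in_family[OF F(1) inv.prems h'])
    ultimately show ?case
      using gen[of R h] inv.hyps by (simp add: R_def)
  next
    case (eng h1 h2)
    have "relabel n h1 P \<in> F"
      using eng by (intro relabel_in_family[OF F(1)]) (auto simp: dihedral_def)
    then show ?case
      using eng comp[of h2 h1 P] unfolding sym_group_mult dihedral_def by metis
  qed
qed

lemma ngon_center_of_center_function:
  assumes g: "ngon_center_function n F g" and F: "closed_family n F" "n \<ge> 2"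
    and \<Phi>: "\<And>P. P \<in> F \<Longrightarrow> (\<Sum>l<n. weight n g P l) \<noteq> 0 \<and> \<Phi> P = weighted_mean n g P"
  shows "ngon_center n F \<Phi>"
  unfolding ngon_center_def
proof (intro conjI allI impI ballI)
  fix T P assume "similarity T" "P \<in> F"
  then show "\<Phi> (map_ngon n T P) = T (\<Phi> P)"
    using weighted_mean_similarity[OF g F(1) _ F(2)] \<Phi> map_ngon_in_family[OF F(1)] by metis
next
  fix P Q assume PQ: "P \<in> F" "Q \<in> F" "differ_only_in_labelling n P Q"
  then obtain \<alpha> where \<alpha>: "\<alpha> \<in> dihedral n" "\<forall>i\<in>{1..n}. Q i = P (\<alpha> i)"
    by (auto simp: differ_only_in_labelling_def)
  have "Q = relabel n \<alpha> P"
    by (rule ngon_eqI[OF closed_family_ngons[OF F(1) PQ(2)] relabel_in_ngons])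
       (simp add: relabel_def \<alpha>(2) del: atLeastAtMost_iff)
  moreover have "\<Phi> (relabel n \<tau> R) = \<Phi> R" if "R \<in> F" "\<tau> \<in> {rho n, sigma n}" for R \<tau>
  proof -
    have "\<tau> \<in> dihedral n"
      using that(2) unfolding dihedral_def by (rule generate.incl)
    then have "\<Phi> (relabel n \<tau> R) = weighted_mean n g (relabel n \<tau> R)"
      using \<Phi> relabel_in_family[OF F(1) that(1)] by blast
    then show ?thesis
      using that \<Phi> weighted_mean_rho[OF F(2)] weighted_mean_sigma[OF g F(1) that(1) F(2)] by auto
  qed
  ultimately show "\<Phi> P = \<Phi> Q"
    using dihedral_invariant[OF F _ \<alpha>(1) PQ(1), of \<Phi>] by simp
qed (rule F)

lemma first_weight_represents:
  assumes "ngon_center n F \<Phi>" "P \<in> F" "n \<ge> 2"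
  shows "(\<Sum>l<n. weight n (first_weight n F \<Phi>) P l) = 1"
    and "weighted_mean n (first_weight n F \<Phi>) P = \<Phi> P"
proof -
  have n1: "n \<ge> 1" using assms(3) by simp
  obtain c where c: "least_barycentric {1..n} P (\<Phi> P) c"
    using ngon_center_least_barycentric_exists[OF assms(1,2) n1] by blast
  have w: "weight n (first_weight n F \<Phi>) P l = c (Suc l)" if "l < n" for l
    using first_weight_permute[OF assms dihedral_rho_funpow c, of l] that n1
    by (simp add: weight_def rho_funpow)
  have "(\<Sum>l<n. c (Suc l)) = (\<Sum>k=1..n. c k)"
    by (rule sum.reindex_bij_witness[of _ "\<lambda>k. k - 1" Suc]) auto
  then show sum1: "(\<Sum>l<n. weight n (first_weight n F \<Phi>) P l) = 1"
    using c by (simp add: w least_barycentric_def barycentric_def)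
  have "(\<Sum>k=1..n. (weight n (first_weight n F \<Phi>) P (k - 1) / 1) *\<^sub>R P k)
      = (\<Sum>k=1..n. c k *\<^sub>R P k)"
    by (rule sum.cong) (auto simp: w)
  also have "\<dots> = \<Phi> P"
    using c unfolding least_barycentric_def barycentric_def by blast
  finally have "(\<Sum>k=1..n. (weight n (first_weight n F \<Phi>) P (k - 1) / 1) *\<^sub>R P k) = \<Phi> P" .
  then show "weighted_mean n (first_weight n F \<Phi>) P = \<Phi> P"
    using weighted_mean_eq[OF n1, of "first_weight n F \<Phi>" P] by (simp only: sum1)
qed

theorem theorem2p3:
  fixes n :: nat
    and F :: "(nat \<Rightarrow> real ^ 2) set"
    and \<Phi> :: "(nat \<Rightarrow> real ^ 2) \<Rightarrow> real ^ 2"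
  assumes "n \<ge> 3"
    and "closed_family n F"
  shows "ngon_center n F \<Phi> \<longleftrightarrow>
    (\<exists>g. ngon_center_function n F g \<and>
      (\<forall>P\<in>F.
        (\<Sum>l=0..n-1. g (permute_matrix n (rho n ^^ l) (dist_matrix n P))) \<noteq> 0 \<and>
        \<Phi> P = (\<Sum>k=1..n.
          (g (permute_matrix n (rho n ^^ (k - 1)) (dist_matrix n P)) /
           (\<Sum>l=0..n-1. g (permute_matrix n (rho n ^^ l) (dist_matrix n P)))) *\<^sub>R P k)))"
proof -
  have n: "n \<ge> 2" "n \<ge> 1" "{0..n - 1} = {..<n}"
    using assms(1) by auto
  \<comment> \<open>In terms of \<open>weight\<close> and \<open>weighted_mean\<close>, with the summation over \<open>{..<n}\<close>:\<close>
  have "ngon_center n F \<Phi> \<longleftrightarrow>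
    (\<exists>g. ngon_center_function n F g \<and>
      (\<forall>P\<in>F. (\<Sum>l<n. weight n g P l) \<noteq> 0 \<and> \<Phi> P = weighted_mean n g P))"
  proof
    assume "ngon_center n F \<Phi>"
    then show "\<exists>g. ngon_center_function n F g \<and>
      (\<forall>P\<in>F. (\<Sum>l<n. weight n g P l) \<noteq> 0 \<and> \<Phi> P = weighted_mean n g P)"
      using first_weight_center_function first_weight_represents n(1)
      by (intro exI[of _ "first_weight n F \<Phi>"]) simp
  next
    assume "\<exists>g. ngon_center_function n F g \<and>
      (\<forall>P\<in>F. (\<Sum>l<n. weight n g P l) \<noteq> 0 \<and> \<Phi> P = weighted_mean n g P)"
    then show "ngon_center n F \<Phi>"
      using ngon_center_of_center_function[OF _ assms(2) n(1)] by blast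
  qed
  then show ?thesis
    unfolding weighted_mean_eq[OF n(2), symmetric] weight_def n(3) .
qed

end
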